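(* Let $n\ge 5$ and let $L_W$ be an $(n-2)$-club in $\mathrm{PG}(1,q^n)$. Then there exist $b\in\mathbb{F}_{q^n}\setminus\mathbb{F}_q$ and $\xi,\eta\in\mathbb{F}_{q^n}^*$ such that $L_W$ is $\mathrm{PGL}(2,q^n)$-equivalent to $L_p=L_{U_p}$, $U_p=\{(x,p(x)): x\in\mathbb{F}_{q^n}\}$, where $p(x)=\mathrm{Tr}_{q^n/q}(\xi x)+b\,\mathrm{Tr}_{q^n/q}(\eta x)$, and $\langle\xi,\eta\rangle_{\mathbb{F}_q}^\perp=\overline{S}\oplus c\langle 1,b,\ldots,b^{t-3}\rangle_{\mathbb{F}_q}$ (the second summand being $\{0\}$ when $t=2$), where $t=[\mathbb{F}_q(b):\mathbb{F}_q]$, $c\in\mathbb{F}_{q^n}^*$, and $\overline{S}$ is an $\mathbb{F}_{q^t}$-subspace of $\mathbb{F}_{q^n}$ of $\mathbb{F}_{q^t}$-dimension $n/t-1$.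
   Context: $q$ is a prime power. For an $\mathbb{F}_q$-subspace $U$ of $\mathbb{F}_{q^n}^2$, $L_U=\{\langle u\rangle_{\mathbb{F}_{q^n}}: u\in U\setminus\{0\}\}\subseteq\mathrm{PG}(1,q^n)$ has rank $\dim_{\mathbb{F}_q}U$; the weight of $P=\langle v\rangle_{\mathbb{F}_{q^n}}$ is $\dim_{\mathbb{F}_q}(U\cap\langle v\rangle_{\mathbb{F}_{q^n}})$. An $(n-2)$-club is an $\mathbb{F}_q$-linear set of rank $n$ with exactly one point of weight $n-2$ and all other points of weight $1$. $\perp$ is taken with respect to the bilinear form $(x,y)\mapsto\mathrm{Tr}_{q^n/q}(xy)$ on $\mathbb{F}_{q^n}$, where $\mathrm{Tr}_{q^n/q}(x)=\sum_{i=0}^{n-1}x^{q^i}$. Linear sets are $\mathrm{PGL}(2,q^n)$-equivalent if a projectivity maps one onto the other. *)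

theory Defs
  imports "HOL-Analysis.Analysis" "HOL-Number_Theory.Prime_Powers"
begin

text \<open>
  The ambient field \<open>F\<close> is a type; its subfields are sets. Since the library's \<open>span\<close>,
  \<open>independent\<close> and \<open>dim\<close> take scalars from a whole type, they are restated here, following
  the library's explicit descriptions, for scalars from a subfield \<open>K\<close> acting through
  a scalar multiplication \<open>s\<close> of \<open>F\<close> on \<open>F\<close> itself or on the plane \<open>F ^ 2\<close>.
\<close>

definition is_subfield :: "'a::field set \<Rightarrow> bool" where
  "is_subfield K \<longleftrightarrow> 0 \<in> K \<and> 1 \<in> K \<and>
     (\<forall>x\<in>K. \<forall>y\<in>K. x + y \<in> K \<and> x * y \<in> K) \<and> (\<forall>x\<in>K. - x \<in> K \<and> inverse x \<in> K)"

definition adjoin :: "'a::field set \<Rightarrow> 'a \<Rightarrow> 'a set" where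
  "adjoin K b = \<Inter>{F. is_subfield F \<and> K \<subseteq> F \<and> b \<in> F}"

definition ksubspace :: "'a::field set \<Rightarrow> ('a \<Rightarrow> 'v \<Rightarrow> 'v) \<Rightarrow> 'v::ab_group_add set \<Rightarrow> bool" where
  "ksubspace K s V \<longleftrightarrow> 0 \<in> V \<and> (\<forall>x\<in>V. \<forall>y\<in>V. x + y \<in> V) \<and> (\<forall>a\<in>K. \<forall>x\<in>V. s a x \<in> V)"

definition kspan :: "'a::field set \<Rightarrow> ('a \<Rightarrow> 'v \<Rightarrow> 'v) \<Rightarrow> 'v::ab_group_add set \<Rightarrow> 'v set" where
  "kspan K s B = {\<Sum>v\<in>A. s (r v) v | A r. finite A \<and> A \<subseteq> B \<and> r ` A \<subseteq> K}"

definition kindependent :: "'a::field set \<Rightarrow> ('a \<Rightarrow> 'v \<Rightarrow> 'v) \<Rightarrow> 'v::ab_group_add set \<Rightarrow> bool" where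
  "kindependent K s B \<longleftrightarrow>
     (\<forall>A r. finite A \<and> A \<subseteq> B \<and> r ` A \<subseteq> K \<and> (\<Sum>v\<in>A. s (r v) v) = 0 \<longrightarrow> (\<forall>v\<in>A. r v = 0))"

definition kdim :: "'a::field set \<Rightarrow> ('a \<Rightarrow> 'v \<Rightarrow> 'v) \<Rightarrow> 'v::ab_group_add set \<Rightarrow> nat" where
  "kdim K s V = card (SOME B. kindependent K s B \<and> kspan K s B = V)"

definition direct_sum :: "'v::ab_group_add set \<Rightarrow> 'v set \<Rightarrow> 'v set \<Rightarrow> bool" where
  "direct_sum V X Y \<longleftrightarrow> V = {x + y | x y. x \<in> X \<and> y \<in> Y} \<and> X \<inter> Y = {0}"

definition linear_set :: "('a::field ^ 2) set \<Rightarrow> ('a ^ 2) set set" where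
  "linear_set U = {vec.span {u} | u. u \<in> U \<and> u \<noteq> 0}"

definition weight :: "'a::field set \<Rightarrow> ('a ^ 2) set \<Rightarrow> ('a ^ 2) set \<Rightarrow> nat" where
  "weight K U P = kdim K (*s) (U \<inter> P)"

definition is_club :: "'a::field set \<Rightarrow> nat \<Rightarrow> nat \<Rightarrow> ('a ^ 2) set \<Rightarrow> bool" where
  "is_club K n i U \<longleftrightarrow> ksubspace K (*s) U \<and> kdim K (*s) U = n \<and>
     (\<exists>!P. P \<in> linear_set U \<and> weight K U P = i) \<and>
     (\<forall>P\<in>linear_set U. weight K U P \<noteq> i \<longrightarrow> weight K U P = 1)"

definition pgl_equivalent :: "('a::field ^ 2) set set \<Rightarrow> ('a ^ 2) set set \<Rightarrow> bool" where
  "pgl_equivalent L L' \<longleftrightarrow>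
     (\<exists>M :: 'a ^ 2 ^ 2. invertible M \<and> (\<lambda>P. (\<lambda>v. M *v v) ` P) ` L = L')"

definition graph_of :: "('a::field \<Rightarrow> 'a) \<Rightarrow> ('a ^ 2) set" where
  "graph_of p = {vector [x, p x] | x. True}"

definition field_trace :: "nat \<Rightarrow> nat \<Rightarrow> 'a::field \<Rightarrow> 'a" where
  "field_trace q n x = (\<Sum>i<n. x ^ (q ^ i))"

definition trace_perp :: "nat \<Rightarrow> nat \<Rightarrow> 'a::field set \<Rightarrow> 'a set" where
  "trace_perp q n S = {x. \<forall>y\<in>S. field_trace q n (x * y) = 0}"

end

theory Submission
  imports Defs "HOL-Computational_Algebra.Polynomial"
begin

text \<open>
  In coordinates where the heavy point is \<open>\<langle>(1, 0)\<rangle>\<close> and \<open>\<langle>(0, 1)\<rangle>\<close> lies off the linear set,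
  \<open>W\<close> is the graph of a \<open>K\<close>-linear map \<open>f\<close> whose kernel \<open>S\<close> has codimension 2; after rescaling,
  its image is \<open>K + Kb\<close>. If \<open>f x0 = 1\<close> and \<open>f y0 = b\<close>, a further point of weight 2 exists iff
  \<open>y0 - b x0 \<in> S + bS\<close>; hence \<open>S + bS\<close> is not the whole field and \<open>(S + bS) / S\<close> has dimension
  at most 1. So in the chain \<open>T\<^sub>i = {x. x, bx, \<dots>, b\<^sup>i\<^sup>-\<^sup>1x \<in> S}\<close> each step after \<open>T\<^sub>1 = S\<close> has codimension
  at most 1. The chain stabilises at a \<open>K(b)\<close>-subspace \<open>S'\<close>, and a vector \<open>c\<close> of the last term before
  that gives \<open>S = S' \<oplus> c\<langle>1, \<dots>, b\<^sup>r\<^sup>-\<^sup>1\<rangle>\<close>, where \<open>r < t = [K(b) : K]\<close>. As \<open>t\<close> divides both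
  \<open>n\<close> and \<open>n - 2 - r\<close>, this forces \<open>r = t - 2\<close>. Dimensions are compared by counting elements.
\<close>

lemma subfield_closed:
  assumes "is_subfield K"
  shows "0 \<in> K" "1 \<in> K" "x \<in> K \<Longrightarrow> y \<in> K \<Longrightarrow> x + y \<in> K" "x \<in> K \<Longrightarrow> y \<in> K \<Longrightarrow> x * y \<in> K"
    "x \<in> K \<Longrightarrow> - x \<in> K" "x \<in> K \<Longrightarrow> inverse x \<in> K"
    "x \<in> K \<Longrightarrow> y \<in> K \<Longrightarrow> x - y \<in> K" "x \<in> K \<Longrightarrow> y \<in> K \<Longrightarrow> x / y \<in> K"
proof -
  show *: "0 \<in> K" "1 \<in> K" "x \<in> K \<Longrightarrow> y \<in> K \<Longrightarrow> x + y \<in> K" "x \<in> K \<Longrightarrow> y \<in> K \<Longrightarrow> x * y \<in> K"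
    "x \<in> K \<Longrightarrow> - x \<in> K" "x \<in> K \<Longrightarrow> inverse x \<in> K" for x y
    using assms by (auto simp: is_subfield_def)
  show "x \<in> K \<Longrightarrow> y \<in> K \<Longrightarrow> x - y \<in> K"
    using *(3)[of x "- y"] *(5)[of y] by simp
  show "x \<in> K \<Longrightarrow> y \<in> K \<Longrightarrow> x / y \<in> K"
    using *(4)[of x "inverse y"] *(6)[of y] by (simp add: divide_inverse)
qed

lemma is_subfield_adjoin: "is_subfield (adjoin K b)"
  unfolding adjoin_def is_subfield_def by blast

lemma subset_adjoin: "K \<subseteq> adjoin K b" and mem_adjoin: "b \<in> adjoin K b"
  unfolding adjoin_def by blast+

lemma adjoin_subset: "is_subfield F \<Longrightarrow> K \<subseteq> F \<Longrightarrow> b \<in> F \<Longrightarrow> adjoin K b \<subseteq> F"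
  unfolding adjoin_def by blast

lemma card_subfield_ge_2:
  fixes K :: "'a::{field,finite} set"
  assumes "is_subfield K"
  shows "2 \<le> card K"
proof -
  have "card {0, 1 :: 'a} \<le> card K"
    by (rule card_mono) (use subfield_closed(1,2)[OF assms] in auto)
  then show ?thesis by simp
qed

locale subfield_space = vector_space s
  for s :: "'a::{field,finite} \<Rightarrow> 'v::{ab_group_add,finite} \<Rightarrow> 'v" +
  fixes K :: "'a set"
  assumes subfield: "is_subfield K"
begin

lemmas K_closed = subfield_closed[OF subfield]

lemma ksubspaceD:
  assumes "ksubspace K s V"
  shows "0 \<in> V" "x \<in> V \<Longrightarrow> y \<in> V \<Longrightarrow> x + y \<in> V" "a \<in> K \<Longrightarrow> x \<in> V \<Longrightarrow> s a x \<in> V"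
    "x \<in> V \<Longrightarrow> - x \<in> V" "x \<in> V \<Longrightarrow> y \<in> V \<Longrightarrow> x - y \<in> V"
proof -
  show *: "0 \<in> V" "x \<in> V \<Longrightarrow> y \<in> V \<Longrightarrow> x + y \<in> V" "a \<in> K \<Longrightarrow> x \<in> V \<Longrightarrow> s a x \<in> V" for a x y
    using assms by (auto simp: ksubspace_def)
  show m: "x \<in> V \<Longrightarrow> - x \<in> V" for x
    using *(3)[of "- 1" x] K_closed(2,5) by (simp add: scale_minus_left)
  show "x \<in> V \<Longrightarrow> y \<in> V \<Longrightarrow> x - y \<in> V"
    using *(2)[of x "- y"] m[of y] by simp
qed

lemma scale_mem_iff:
  assumes "ksubspace K s V" "a \<in> K" "a \<noteq> 0"
  shows "s a x \<in> V \<longleftrightarrow> x \<in> V"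
proof
  assume "s a x \<in> V"
  then have "s (inverse a) (s a x) \<in> V"
    using ksubspaceD(3)[OF assms(1)] K_closed(6) assms(2) by blast
  then show "x \<in> V"
    using assms(3) by simp
qed (use ksubspaceD(3)[OF assms(1)] assms(2) in blast)

lemma ksubspace_sum:
  "ksubspace K s V \<Longrightarrow> (\<And>x. x \<in> A \<Longrightarrow> f x \<in> V) \<Longrightarrow> (\<Sum>x\<in>A. f x) \<in> V"
  by (induction A rule: infinite_finite_induct) (simp_all add: ksubspaceD)

lemma kspan_subset: "ksubspace K s V \<Longrightarrow> B \<subseteq> V \<Longrightarrow> kspan K s B \<subseteq> V"
  unfolding kspan_def by (auto intro!: ksubspace_sum ksubspaceD(3))

lemma kspan_finite: "kspan K s B = {\<Sum>v\<in>B. s (r v) v | r. r ` B \<subseteq> K}"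
proof -
  have "\<exists>r'. (\<Sum>v\<in>A. s (r v) v) = (\<Sum>v\<in>B. s (r' v) v) \<and> r' ` B \<subseteq> K"
    if "A \<subseteq> B" "r ` A \<subseteq> K" for A r
  proof (intro exI conjI)
    show "(\<Sum>v\<in>A. s (r v) v) = (\<Sum>v\<in>B. s (if v \<in> A then r v else 0) v)"
      by (rule sum.mono_neutral_cong_left) (use that in auto)
    show "(\<lambda>v. if v \<in> A then r v else 0) ` B \<subseteq> K"
      using that K_closed(1) by auto
  qed
  then show ?thesis
    unfolding kspan_def by (fastforce intro: finite)
qed

lemma kspan_empty: "kspan K s {} = {0}"
  by (auto simp: kspan_def)

lemma kspan_insert: "kspan K s (insert v B) = {x + s a v | x a. x \<in> kspan K s B \<and> a \<in> K}"
proof (cases "v \<in> B")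
  case False
  show ?thesis
  proof (intro equalityI subsetI)
    fix y assume "y \<in> kspan K s (insert v B)"
    then obtain r where r: "r ` insert v B \<subseteq> K" "y = (\<Sum>w\<in>insert v B. s (r w) w)"
      unfolding kspan_finite by blast
    then have "y = (\<Sum>w\<in>B. s (r w) w) + s (r v) v"
      using False by (simp add: add.commute)
    with r(1) show "y \<in> {x + s a v | x a. x \<in> kspan K s B \<and> a \<in> K}"
      unfolding kspan_finite by blast
  next
    fix y assume "y \<in> {x + s a v | x a. x \<in> kspan K s B \<and> a \<in> K}"
    then obtain r a where r: "r ` B \<subseteq> K" "a \<in> K" "y = (\<Sum>w\<in>B. s (r w) w) + s a v"
      unfolding kspan_finite by blast
    have "(\<Sum>w\<in>B. s ((r(v := a)) w) w) = (\<Sum>w\<in>B. s (r w) w)"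
      by (rule sum.cong) (use False in auto)
    then have "y = (\<Sum>w\<in>insert v B. s ((r(v := a)) w) w)"
      using False r(3) by (simp add: add.commute)
    moreover have "(r(v := a)) ` insert v B \<subseteq> K"
      using r by auto
    ultimately show "y \<in> kspan K s (insert v B)"
      unfolding kspan_finite by blast
  qed
next
  case True
  have "x + s a v \<in> kspan K s B" if x: "x \<in> kspan K s B" and a: "a \<in> K" for x a
  proof -
    obtain r where r: "r ` B \<subseteq> K" "x = (\<Sum>w\<in>B. s (r w) w)"
      using x unfolding kspan_finite by blast
    have "(\<Sum>w\<in>B. s (r w + (if w = v then a else 0)) w)
        = x + (\<Sum>w\<in>B. if w = v then s a v else 0)"
      unfolding r(2) sum.distrib[symmetric]
      by (rule sum.cong) (auto simp: scale_left_distrib)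
    also have "\<dots> = x + s a v"
      using True by simp
    finally have "x + s a v = (\<Sum>w\<in>B. s (r w + (if w = v then a else 0)) w)" ..
    moreover have "(\<lambda>w. r w + (if w = v then a else 0)) ` B \<subseteq> K"
      using r(1) a K_closed by auto
    ultimately show ?thesis
      unfolding kspan_finite by (intro CollectI exI[of _ "\<lambda>w. r w + (if w = v then a else 0)"] conjI)
  qed
  moreover have "x = x + s 0 v" for x by simp
  ultimately show ?thesis
    unfolding insert_absorb[OF True] using K_closed(1) by blast
qed

lemma ksubspace_add_line:
  assumes "ksubspace K s V"
  shows "ksubspace K s {x + s a v | x a. x \<in> V \<and> a \<in> K}"
  unfolding ksubspace_def
proof (intro conjI ballI)
  note V = ksubspaceD[OF assms]
  show "0 \<in> {x + s a v | x a. x \<in> V \<and> a \<in> K}"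
    using V(1) K_closed(1) by force
  fix y assume "y \<in> {x + s a v | x a. x \<in> V \<and> a \<in> K}"
  then obtain x a where y: "x \<in> V" "a \<in> K" "y = x + s a v" by blast
  show "y + z \<in> {x + s a v | x a. x \<in> V \<and> a \<in> K}"
    if "z \<in> {x + s a v | x a. x \<in> V \<and> a \<in> K}" for z
  proof -
    obtain x' a' where z: "x' \<in> V" "a' \<in> K" "z = x' + s a' v"
      using \<open>z \<in> _\<close> by blast
    have "y + z = (x + x') + s (a + a') v"
      using y z by (simp add: scale_left_distrib)
    then show ?thesis
      using y z V(2) K_closed(3) by blast
  qed
  show "s k y \<in> {x + s a v | x a. x \<in> V \<and> a \<in> K}" if "k \<in> K" for k
  proof -
    have "s k y = s k x + s (k * a) v"
      using y by (simp add: scale_right_distrib)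
    then show ?thesis
      using y that V(3) K_closed(4) by blast
  qed
qed

lemma ksubspace_kspan: "ksubspace K s (kspan K s B)"
  using finite[of B]
proof (induction B rule: finite_induct)
  case empty
  show ?case by (simp add: kspan_empty ksubspace_def)
next
  case (insert v B)
  then show ?case
    unfolding kspan_insert by (intro ksubspace_add_line)
qed

lemma kspan_superset: "B \<subseteq> kspan K s B"
proof
  fix v assume "v \<in> B"
  have "0 + s 1 v \<in> kspan K s (insert v B)"
    unfolding kspan_insert using ksubspaceD(1)[OF ksubspace_kspan] K_closed(2) by blast
  then show "v \<in> kspan K s B"
    using \<open>v \<in> B\<close> by (simp add: insert_absorb)
qed

lemma card_add_line:
  assumes V: "ksubspace K s V" and v: "v \<notin> V"
  shows "card {x + s a v | x a. x \<in> V \<and> a \<in> K} = card K * card V"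
proof -
  have "inj_on (\<lambda>(x, a). x + s a v) (V \<times> K)"
  proof (rule inj_onI, clarify)
    fix x a x' a'
    assume *: "x \<in> V" "x' \<in> V" "a \<in> K" "a' \<in> K" "x + s a v = x' + s a' v"
    then have "s (a - a') v = x' - x"
      by (simp add: scale_left_diff_distrib algebra_simps)
    then have "s (a - a') v \<in> V"
      using * ksubspaceD(5)[OF V] by simp
    then have "a = a'"
      using v scale_mem_iff[OF V, of "a - a'" v] K_closed(7)[of a a'] * by force
    with * show "x = x' \<and> a = a'" by simp
  qed
  then have "card ((\<lambda>(x, a). x + s a v) ` (V \<times> K)) = card V * card K"
    by (simp add: card_image card_cartesian_product)
  moreover have "(\<lambda>(x, a). x + s a v) ` (V \<times> K) = {x + s a v | x a. x \<in> V \<and> a \<in> K}"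
    by auto
  ultimately show ?thesis by simp
qed

lemma kindependent_insert:
  assumes "v \<notin> B"
  shows "kindependent K s (insert v B) \<longleftrightarrow> kindependent K s B \<and> v \<notin> kspan K s B"
proof safe
  assume ind: "kindependent K s (insert v B)"
  then show "kindependent K s B"
    unfolding kindependent_def by blast
  assume "v \<in> kspan K s B"
  then obtain r where r: "r ` B \<subseteq> K" "v = (\<Sum>w\<in>B. s (r w) w)"
    unfolding kspan_finite by blast
  have "(\<Sum>w\<in>B. s ((r(v := - 1)) w) w) = (\<Sum>w\<in>B. s (r w) w)"
    by (rule sum.cong) (use assms in auto)
  then have "(\<Sum>w\<in>insert v B. s ((r(v := - 1)) w) w) = 0"
    using assms r(2) by (simp add: scale_minus_left)
  moreover have "(r(v := - 1)) ` insert v B \<subseteq> K"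
    using r(1) K_closed(2,5) by auto
  ultimately have "\<forall>w\<in>insert v B. (r(v := - 1)) w = 0"
    using ind finite[of "insert v B"] unfolding kindependent_def by blast
  then show False by simp
next
  assume ind: "kindependent K s B" and v: "v \<notin> kspan K s B"
  show "kindependent K s (insert v B)"
    unfolding kindependent_def
  proof (intro allI impI, elim conjE)
    fix A r
    assume A: "A \<subseteq> insert v B" "r ` A \<subseteq> K" "(\<Sum>w\<in>A. s (r w) w) = 0"
    have mem: "(\<Sum>w\<in>A - {v}. s (r w) w) \<in> kspan K s B"
      unfolding kspan_def using A finite[of "A - {v}"] by blast
    have "r v = 0" if "v \<in> A"
    proof (rule ccontr)
      assume "r v \<noteq> 0"
      have "s (r v) v = - (\<Sum>w\<in>A - {v}. s (r w) w)"
        using A(3) that by (simp add: sum.remove eq_neg_iff_add_eq_0)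
      also have "\<dots> \<in> kspan K s B"
        using ksubspaceD(4)[OF ksubspace_kspan mem] .
      finally show False
        using v scale_mem_iff[OF ksubspace_kspan, of "r v" v] that A(2) \<open>r v \<noteq> 0\<close> by blast
    qed
    then have "(\<Sum>w\<in>A - {v}. s (r w) w) = 0"
      using A(3) by (cases "v \<in> A") (auto simp: sum.remove)
    moreover have "A - {v} \<subseteq> B" "r ` (A - {v}) \<subseteq> K" "finite (A - {v})"
      using A by auto
    ultimately have "\<forall>w\<in>A - {v}. r w = 0"
      using ind unfolding kindependent_def by blast
    with \<open>v \<in> A \<Longrightarrow> r v = 0\<close> show "\<forall>w\<in>A. r w = 0" by blast
  qed
qed

lemma card_kspan_independent: "kindependent K s B \<Longrightarrow> card (kspan K s B) = card K ^ card B"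
  using finite[of B]
proof (induction B rule: finite_induct)
  case empty
  show ?case by (simp add: kspan_empty)
next
  case (insert v B)
  then show ?case
    using card_add_line[OF ksubspace_kspan, of v B] by (simp add: kindependent_insert kspan_insert)
qed

lemma exists_kbasis:
  assumes V: "ksubspace K s V"
  obtains B where "kindependent K s B" "kspan K s B = V"
proof -
  let ?P = "\<lambda>B. kindependent K s B \<and> B \<subseteq> V"
  have "?P {}" by (simp add: kindependent_def)
  moreover have "\<forall>B. ?P B \<longrightarrow> card B < Suc (card V)"
    by (auto simp: less_Suc_eq_le intro: card_mono)
  ultimately obtain B where B: "?P B" and max: "\<And>B'. ?P B' \<Longrightarrow> card B' \<le> card B"
    using ex_has_greatest_nat[of ?P "{}" card "Suc (card V)"] by blast
  have "V \<subseteq> kspan K s B"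
  proof (rule subsetI, rule ccontr)
    fix v assume v: "v \<in> V" "v \<notin> kspan K s B"
    then have "v \<notin> B" using kspan_superset by blast
    with v B have "?P (insert v B)"
      by (simp add: kindependent_insert)
    from max[OF this] \<open>v \<notin> B\<close> show False by simp
  qed
  with B kspan_subset[OF V] that show ?thesis by blast
qed

lemma kdim_basis:
  assumes "ksubspace K s V"
  obtains B where "kindependent K s B" "kspan K s B = V" "card B = kdim K s V"
proof -
  let ?B = "SOME B. kindependent K s B \<and> kspan K s B = V"
  have "kindependent K s ?B \<and> kspan K s ?B = V"
    by (rule someI_ex) (metis exists_kbasis assms)
  then show ?thesis using that[of ?B] by (simp add: kdim_def)
qed

lemma card_ksubspace: "ksubspace K s V \<Longrightarrow> card V = card K ^ kdim K s V"
  by (metis kdim_basis card_kspan_independent)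

end

definition klinear :: "'a::field set \<Rightarrow> ('a \<Rightarrow> 'a) \<Rightarrow> bool" where
  "klinear K f \<longleftrightarrow> (\<forall>x y. f (x + y) = f x + f y) \<and> (\<forall>a\<in>K. \<forall>x. f (a * x) = a * f x)"

lemma klinearD:
  assumes "klinear K f"
  shows "f (x + y) = f x + f y" "a \<in> K \<Longrightarrow> f (a * x) = a * f x" "f 0 = 0" "f (- x) = - f x"
    "f (x - y) = f x - f y"
proof -
  show add: "f (x + y) = f x + f y" "a \<in> K \<Longrightarrow> f (a * x) = a * f x" for x y
    using assms by (auto simp: klinear_def)
  show "f 0 = 0" using add(1)[of 0 0] by (metis add.right_neutral add_left_cancel)
  then show minus: "f (- x) = - f x" for x
    using add(1)[of x "- x"] by (simp add: eq_neg_iff_add_eq_0 add.commute)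
  show "f (x - y) = f x - f y"
    using add(1)[of x "- y"] minus[of y] by simp
qed

lemma klinear_sum: "klinear K f \<Longrightarrow> f (\<Sum>i\<in>A. g i) = (\<Sum>i\<in>A. f (g i))"
  by (induction A rule: infinite_finite_induct) (simp_all add: klinearD)

lemma subfield_power_card:
  fixes K :: "'a::{field,finite} set"
  assumes K: "is_subfield K" and x: "x \<in> K"
  shows "x ^ card K = x"
proof (cases "x = 0")
  case True
  then show ?thesis using card_subfield_ge_2[OF K] by (simp add: zero_power)
next
  case False
  note cl = subfield_closed[OF K]
  have "(\<Prod>y\<in>K - {0}. y) = (\<Prod>y\<in>K - {0}. x * y)"
    by (rule prod.reindex_bij_witness[of _ "\<lambda>y. x * y" "\<lambda>y. y / x"]) (use False cl x in auto)
  also have "\<dots> = x ^ (card K - 1) * (\<Prod>y\<in>K - {0}. y)"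
    using cl(1) by (simp add: prod.distrib)
  finally have "x ^ (card K - 1) = 1" by simp
  moreover have "card K = Suc (card K - 1)"
    using card_subfield_ge_2[OF K] by simp
  ultimately show ?thesis
    by (metis power_Suc mult.right_neutral)
qed

locale finite_extension =
  fixes K :: "'a::{field,finite} set" and q n :: nat
  assumes primepow_q: "primepow q" and card_field: "CARD('a) = q ^ n"
    and K_subfield: "is_subfield K" and card_K: "card K = q"
begin

sublocale subfield_space "(*)" K
  using K_subfield by unfold_locales

declare scale_scale [simp del]

lemma q_ge_2: "2 \<le> q"
  using card_subfield_ge_2[OF K_subfield] card_K by simp

lemma power_q_cancel: "q ^ i = q ^ j \<longleftrightarrow> i = j"
  using q_ge_2 by simp

lemma CHAR_power: "\<exists>k>0. q = CHAR('a) ^ k" and prime_CHAR: "prime CHAR('a)"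
proof -
  show p: "prime CHAR('a)"
    using prime_CHAR_semidom[where 'a = 'a] finite_imp_CHAR_pos[where 'a = 'a] by simp
  obtain l k where l: "prime l" "k > 0" "q = l ^ k"
    using primepow_q unfolding primepow_def by blast
  have "(\<Sum>x\<in>UNIV. x :: 'a) = (\<Sum>x\<in>UNIV. x + 1)"
    by (rule sum.reindex_bij_witness[of _ "\<lambda>x. x + 1" "\<lambda>x. x - 1"]) auto
  then have "of_nat (CARD('a)) = (0 :: 'a)"
    by (simp add: sum.distrib)
  then have "CHAR('a) dvd l ^ (k * n)"
    by (simp only: of_nat_eq_0_iff_char_dvd card_field l(3) power_mult)
  then have "CHAR('a) = l"
    using p l(1) by (metis prime_dvd_power primes_dvd_imp_eq)
  with l show "\<exists>k>0. q = CHAR('a) ^ k" by blast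
qed

lemma power_q_sum: "(\<Sum>i\<in>A. f i :: 'a) ^ (q ^ j) = (\<Sum>i\<in>A. f i ^ (q ^ j))"
proof -
  obtain k where "q = CHAR('a) ^ k" using CHAR_power by blast
  then have "q ^ j = CHAR('a) ^ (k * j)" by (simp add: power_mult)
  then show ?thesis by (rule freshmans_dream_sum'[OF prime_CHAR])
qed

lemma power_q_add: "(x + y :: 'a) ^ (q ^ j) = x ^ (q ^ j) + y ^ (q ^ j)"
proof -
  obtain k where "q = CHAR('a) ^ k" using CHAR_power by blast
  then have "q ^ j = CHAR('a) ^ (k * j)" by (simp add: power_mult)
  then show ?thesis by (rule freshmans_dream'[OF prime_CHAR])
qed

lemma power_q_K: "a \<in> K \<Longrightarrow> a ^ (q ^ j) = a"
  by (induction j) (auto simp: power_mult subfield_power_card[OF K_subfield, unfolded card_K])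

lemma power_card_field: "(x :: 'a) ^ (q ^ n) = x"
  using subfield_power_card[of UNIV x] card_field by (simp add: is_subfield_def)

lemma n_pos: "0 < n"
proof (rule ccontr)
  assume "\<not> 0 < n"
  then have "CARD('a) = 1" using card_field by simp
  then show False
    using card_subfield_ge_2[of "UNIV :: 'a set"] by (simp add: is_subfield_def)
qed

lemma fixed_power_q_iff: "(x :: 'a) ^ q = x \<longleftrightarrow> x \<in> K"
proof -
  let ?p = "monom 1 q - monom 1 1 :: 'a poly"
  have "coeff ?p q = 1" using q_ge_2 by simp
  then have p: "?p \<noteq> 0" by (metis coeff_0 zero_neq_one)
  have "degree ?p \<le> q"
    using q_ge_2 by (intro degree_diff_le) (auto simp: degree_monom_eq)
  with card_poly_roots_bound[OF p] have "card {x. poly ?p x = 0} \<le> q" by simp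
  moreover have roots: "{x. poly ?p x = 0} = {x. x ^ q = x}"
    by (simp add: poly_monom)
  moreover have "K \<subseteq> {x. x ^ q = x}"
    using subfield_power_card[OF K_subfield] card_K by auto
  ultimately have "K = {x. x ^ q = x}"
    by (intro card_seteq) (auto simp: card_K)
  then show ?thesis by blast
qed

abbreviation Tr :: "'a \<Rightarrow> 'a" where "Tr \<equiv> field_trace q n"

lemma trace_mem: "Tr x \<in> K"
proof -
  have "Tr x ^ q = (\<Sum>i<n. x ^ (q ^ Suc i))"
    using power_q_sum[of "\<lambda>i. x ^ (q ^ i)" "{..<n}" 1]
    by (simp add: field_trace_def mult.commute flip: power_mult)
  also have "\<dots> + x ^ (q ^ 0) = Tr x + x ^ (q ^ n)"
    using sum.lessThan_Suc_shift[of "\<lambda>i. x ^ (q ^ i)" n]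
    by (simp add: field_trace_def add.commute)
  finally show ?thesis
    by (simp add: power_card_field fixed_power_q_iff)
qed

lemma klinear_trace: "klinear K Tr"
  unfolding klinear_def field_trace_def
  by (auto simp: power_q_add sum.distrib power_mult_distrib power_q_K sum_distrib_left)

lemma klinear_trace_mult: "klinear K (\<lambda>x. Tr (\<xi> * x))"
  unfolding klinear_def using klinearD(1,2)[OF klinear_trace]
  by (simp add: distrib_left mult.left_commute)

lemma trace_nonzero: "\<exists>x. Tr x \<noteq> 0"
proof (rule ccontr)
  assume *: "\<nexists>x. Tr x \<noteq> 0"
  define p :: "'a poly" where "p = (\<Sum>i<n. monom 1 (q ^ i))"
  have "coeff p (q ^ (n - 1)) = (\<Sum>i<n. if i = n - 1 then 1 else 0)"
    unfolding p_def coeff_sum by (rule sum.cong) (auto simp: power_q_cancel)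
  then have "coeff p (q ^ (n - 1)) = 1" using n_pos by simp
  then have "p \<noteq> 0" by (metis coeff_0 zero_neq_one)
  then have "card {x. poly p x = 0} \<le> degree p"
    by (rule card_poly_roots_bound)
  moreover have "{x. poly p x = 0} = UNIV"
    using * by (auto simp: p_def poly_sum poly_monom field_trace_def)
  moreover have "degree p \<le> q ^ (n - 1)"
    unfolding p_def using q_ge_2
    by (intro degree_sum_le) (auto simp: degree_monom_eq intro!: power_increasing)
  ultimately have "q ^ n \<le> q ^ (n - 1)" by (simp add: card_field)
  then have "n \<le> n - 1"
    using q_ge_2 by simp
  with n_pos show False by simp
qed

lemma ksubspace_UNIV: "ksubspace K (*) UNIV"
  by (simp add: ksubspace_def)

lemma functional_eq_trace:
  assumes f: "klinear K f" "range f \<subseteq> K"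
  obtains \<xi> where "f = (\<lambda>x. Tr (\<xi> * x))"
proof -
  define L where "L = {f. klinear K f \<and> range f \<subseteq> K}"
  define T where "T = (\<lambda>\<xi> x. Tr (\<xi> * x))"
  obtain B where B: "kindependent K (*) B" "kspan K (*) B = UNIV"
    using exists_kbasis[OF ksubspace_UNIV] .
  have "card B = n"
    using card_kspan_independent[OF B(1)] B(2) card_field power_q_cancel by (simp add: card_K)
  have "inj_on (\<lambda>f. restrict f B) L"
  proof (rule inj_onI)
    fix f g assume fg: "f \<in> L" "g \<in> L" "restrict f B = restrict g B"
    show "f = g"
    proof
      fix x
      obtain r where r: "r ` B \<subseteq> K" "x = (\<Sum>v\<in>B. r v * v)"
        using B(2) unfolding kspan_finite by blast
      have lin: "h x = (\<Sum>v\<in>B. r v * h v)" if "h \<in> L" for h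
      proof -
        have h: "klinear K h" using that by (simp add: L_def)
        show ?thesis
          unfolding r(2) klinear_sum[OF h]
          by (rule sum.cong) (use r(1) klinearD(2)[OF h] in auto)
      qed
      have "\<And>v. v \<in> B \<Longrightarrow> f v = g v"
        using fg(3) by (metis restrict_apply')
      then show "f x = g x" unfolding lin[OF fg(1)] lin[OF fg(2)] by simp
    qed
  qed
  moreover have "(\<lambda>f. restrict f B) ` L \<subseteq> B \<rightarrow>\<^sub>E K"
    by (auto simp: L_def)
  ultimately have "card L \<le> card (B \<rightarrow>\<^sub>E K)"
    by (rule card_inj_on_le) simp
  also have "\<dots> = CARD('a)"
    using \<open>card B = n\<close> by (simp add: card_PiE card_K card_field)
  also have "\<dots> = card (range T)"
  proof -
    have "inj T"
    proof (rule injI, rule ccontr)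
      fix \<xi> \<eta> assume *: "T \<xi> = T \<eta>" "\<xi> \<noteq> \<eta>"
      obtain z where "Tr z \<noteq> 0" using trace_nonzero by blast
      moreover have "Tr (\<xi> * (z / (\<xi> - \<eta>))) - Tr (\<eta> * (z / (\<xi> - \<eta>))) = 0"
        using fun_cong[OF *(1), of "z / (\<xi> - \<eta>)"] by (simp add: T_def)
      moreover have "Tr (\<xi> * (z / (\<xi> - \<eta>))) - Tr (\<eta> * (z / (\<xi> - \<eta>)))
          = Tr ((\<xi> - \<eta>) * (z / (\<xi> - \<eta>)))"
        by (simp only: klinearD(5)[OF klinear_trace, symmetric] left_diff_distrib)
      ultimately show False using *(2) by simp
    qed
    then show ?thesis by (simp add: card_image)
  qed
  finally have "range T = L"
    by (intro card_seteq) (auto simp: L_def T_def trace_mem klinear_trace_mult)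
  then show ?thesis
    using that f unfolding L_def T_def by blast
qed

lemma ksubspace_preimage_powers:
  assumes "ksubspace K (*) S"
  shows "ksubspace K (*) {x. \<forall>k<i. b ^ k * x \<in> S}"
  unfolding ksubspace_def
  using ksubspaceD[OF assms] by (auto simp: distrib_left mult.left_commute[of "b ^ _" "_ :: 'a"])

lemma ksubspace_adjoin:
  assumes V: "ksubspace K (*) V" and b: "\<And>x. x \<in> V \<Longrightarrow> b * x \<in> V"
  shows "ksubspace (adjoin K b) (*) V"
proof -
  let ?F = "{a. \<forall>x\<in>V. a * x \<in> V}"
  have "inverse a \<in> ?F" if a: "a \<in> ?F" for a
  proof (cases "a = 0")
    case False
    have "(*) a ` V \<subseteq> V" using a by auto
    moreover have "card ((*) a ` V) = card V"
      using False by (simp add: card_image inj_on_def)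
    ultimately have surj: "(*) a ` V = V"
      by (intro card_subset_eq) auto
    show ?thesis
    proof (intro CollectI ballI)
      fix x assume "x \<in> V"
      then obtain y where "y \<in> V" "x = a * y" using surj by auto
      then show "inverse a * x \<in> V" using False by (simp flip: mult.assoc)
    qed
  qed (use a in simp)
  then have "is_subfield ?F"
    using ksubspaceD[OF V] by (auto simp: is_subfield_def distrib_right mult.assoc)
  then have "adjoin K b \<subseteq> ?F"
    using ksubspaceD(3)[OF V] b by (intro adjoin_subset) auto
  then show ?thesis
    using ksubspaceD(1,2)[OF V] by (auto simp: ksubspace_def)
qed

lemma subspace_shift_structure:
  assumes S: "ksubspace K (*) S" and card_S: "card S = q ^ (n - 2)" and n: "2 \<le> n"
    and b: "b \<notin> K" and shift: "z \<notin> {x + b * y | x y. x \<in> S \<and> y \<in> S}"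
  defines "t \<equiv> kdim K (*) (adjoin K b)"
  obtains c S' where "c \<noteq> 0" "ksubspace (adjoin K b) (*) S'"
    "kdim (adjoin K b) (*) S' = n div t - 1"
    "direct_sum S S' ((\<lambda>x. c * x) ` kspan K (*) ((\<lambda>i. b ^ i) ` {..<t - 2}))"
proof -
  note Sd = ksubspaceD[OF S]
  define T where "T i = {x. \<forall>k<i. b ^ k * x \<in> S}" for i
  have T: "ksubspace K (*) (T i)" for i
    unfolding T_def by (rule ksubspace_preimage_powers[OF S])
  note Td = ksubspaceD[OF T]
  have T1: "T 1 = S" by (auto simp: T_def)
  have T_Suc: "T (Suc i) = {x \<in> T i. b ^ i * x \<in> S}" for i
    by (auto simp: T_def less_Suc_eq)
  have T_antimono: "T j \<subseteq> T i" if "i \<le> j" for i j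
    using that by (auto simp: T_def)

  have line: "\<exists>a\<in>K. b * u - a * (b * v) \<in> S" if "u \<in> S" "v \<in> S" "b * v \<notin> S" for u v
  proof (rule ccontr)
    assume no: "\<not> ?thesis"
    let ?V = "{x + a * (b * v) | x a. x \<in> S \<and> a \<in> K}"
    let ?U = "{x + a * (b * u) | x a. x \<in> ?V \<and> a \<in> K}"
    have V: "ksubspace K (*) ?V" by (rule ksubspace_add_line[OF S])
    have "b * u \<notin> ?V"
    proof
      assume "b * u \<in> ?V"
      then obtain x a where "x \<in> S" "a \<in> K" "b * u = x + a * (b * v)" by blast
      then show False using no by auto
    qed
    then have "card ?U = q * (q * card S)"
      using card_add_line[OF V] card_add_line[OF S \<open>b * v \<notin> S\<close>] by (simp add: card_K)
    also have "\<dots> = q ^ Suc (Suc (n - 2))" by (simp add: card_S)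
    also have "Suc (Suc (n - 2)) = n" using n by simp
    also have "q ^ n = CARD('a)" by (simp add: card_field)
    finally have "?U = UNIV" by (intro card_subset_eq) auto
    then have "z \<in> ?U" by simp
    then obtain x a a' where x: "x \<in> S" "a \<in> K" "a' \<in> K" "z = x + a * (b * v) + a' * (b * u)"
      by blast
    then have "z = x + b * (a * v + a' * u)" by (simp add: algebra_simps)
    moreover have "a * v + a' * u \<in> S"
      using x that Sd(2,3) by blast
    ultimately show False using shift x(1) by blast
  qed
  have drop: "\<exists>a\<in>K. x - a * y \<in> T (Suc (Suc i))"
    if x: "x \<in> T (Suc i)" and y: "y \<in> T (Suc i)" "y \<notin> T (Suc (Suc i))" for x y i
  proof -
    have "b ^ i * x \<in> S" "b ^ i * y \<in> S" "b * (b ^ i * y) \<notin> S"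
      using x y unfolding T_Suc by (auto simp: mult.assoc)
    then obtain a where a: "a \<in> K" "b * (b ^ i * x) - a * (b * (b ^ i * y)) \<in> S"
      using line by blast
    then have "b ^ Suc i * (x - a * y) \<in> S"
      by (simp add: algebra_simps)
    moreover have "x - a * y \<in> T (Suc i)"
      using Td(3,5) x y(1) a(1) by blast
    ultimately show ?thesis
      using a(1) T_Suc[of "Suc i"] by blast
  qed

  have "\<exists>m. T m = T (Suc m)"
  proof (rule ccontr)
    assume no: "\<nexists>m. T m = T (Suc m)"
    have "card (T m) + m \<le> CARD('a)" for m
    proof (induction m)
      case 0
      show ?case by (simp add: card_mono)
    next
      case (Suc m)
      have "T (Suc m) \<subset> T m" using no T_antimono[of m "Suc m"] by auto
      then have "card (T (Suc m)) < card (T m)" by (intro psubset_card_mono) auto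
      with Suc show ?case by simp
    qed
    from this[of "Suc (CARD('a))"] show False by simp
  qed
  then obtain m where m: "T m = T (Suc m)" and least: "\<And>i. i < m \<Longrightarrow> T i \<noteq> T (Suc i)"
    using exists_least_iff[of "\<lambda>m. T m = T (Suc m)"] by blast
  have "S \<noteq> UNIV"
  proof
    assume "S = UNIV"
    moreover have "z = z + b * 0" by simp
    ultimately show False using shift by blast
  qed
  then have "T 0 \<noteq> T (Suc 0)" using T1 by (simp add: T_def)
  with m obtain r where r: "m = Suc r" by (cases m) auto
  define S' where "S' = T (Suc r)"
  have S': "ksubspace K (*) S'" unfolding S'_def by (rule T)
  have "b * x \<in> S'" if "x \<in> S'" for x
  proof -
    have "x \<in> T (Suc m)" using that m r by (simp add: S'_def)
    then have "\<forall>k<m. b ^ Suc k * x \<in> S" unfolding T_def by blast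
    then show ?thesis by (simp add: S'_def r[symmetric] T_def mult.assoc mult.left_commute)
  qed
  then have S'_adj: "ksubspace (adjoin K b) (*) S'"
    by (rule ksubspace_adjoin[OF S'])

  obtain c where c: "c \<in> T r" "c \<notin> T (Suc r)"
    using least[of r] r T_antimono[of r "Suc r"] by auto
  then have "c \<noteq> 0" using Td(1) by blast
  have bc: "b ^ k * c \<in> S" if "k < r" for k
    using c(1) that by (simp add: T_def)
  have bcr: "b ^ r * c \<notin> S"
    using c T_Suc by blast
  have bc_in: "b ^ j * c \<in> T (r - j)" if "j \<le> r" for j
  proof -
    have "b ^ k * (b ^ j * c) \<in> S" if "k < r - j" for k
      using bc[of "k + j"] that by (simp add: power_add mult.assoc)
    then show ?thesis by (simp add: T_def)
  qed
  have bc_notin: "b ^ j * c \<notin> T (Suc (r - j))" if "j \<le> r" for j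
  proof
    assume "b ^ j * c \<in> T (Suc (r - j))"
    then have "b ^ (r - j) * (b ^ j * c) \<in> S" by (simp add: T_def)
    also have "b ^ (r - j) * (b ^ j * c) = b ^ r * c"
      using that by (simp flip: power_add mult.assoc)
    finally show False using bcr by simp
  qed

  define P where "P j = kspan K (*) ((\<lambda>i. b ^ i) ` {..<j})" for j
  have P: "ksubspace K (*) (P j)" for j
    unfolding P_def by (rule ksubspace_kspan)
  note Pd = ksubspaceD[OF P]
  have P0: "P 0 = {0}" by (simp add: P_def kspan_empty)
  have P_Suc: "P (Suc j) = {x + a * b ^ j | x a. x \<in> P j \<and> a \<in> K}" for j
    by (simp add: P_def lessThan_Suc kspan_insert)

  have T_decomp: "T (Suc r - j) = {x + c * y | x y. x \<in> S' \<and> y \<in> P j}" if "j \<le> r" for j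
    using that
  proof (induction j)
    case 0
    then show ?case by (simp add: S'_def P0)
  next
    case (Suc j)
    then have j: "j < r" "Suc r - Suc j = Suc (r - Suc j)" "Suc r - j = Suc (Suc (r - Suc j))"
      "r - j = Suc (r - Suc j)"
      by auto
    have IH: "T (Suc (Suc (r - Suc j))) = {x + c * y | x y. x \<in> S' \<and> y \<in> P j}"
      using Suc j by simp
    have in': "b ^ j * c \<in> T (Suc (r - Suc j))" and notin': "b ^ j * c \<notin> T (Suc (Suc (r - Suc j)))"
      using bc_in[of j] bc_notin[of j] j by auto
    show ?case
      unfolding j(2)
    proof (intro equalityI subsetI)
      fix x assume "x \<in> T (Suc (r - Suc j))"
      then obtain a where a: "a \<in> K" "x - a * (b ^ j * c) \<in> T (Suc (Suc (r - Suc j)))"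
        using drop[OF _ in' notin'] by blast
      then obtain u y where u: "u \<in> S'" "y \<in> P j" "x - a * (b ^ j * c) = u + c * y"
        unfolding IH by blast
      have "x = u + c * (y + a * b ^ j)"
        using u(3) by (simp add: algebra_simps)
      moreover have "y + a * b ^ j \<in> P (Suc j)"
        unfolding P_Suc using u(2) a(1) by blast
      ultimately show "x \<in> {x + c * y | x y. x \<in> S' \<and> y \<in> P (Suc j)}"
        using u(1) by blast
    next
      fix x assume "x \<in> {x + c * y | x y. x \<in> S' \<and> y \<in> P (Suc j)}"
      then obtain u y a where u: "u \<in> S'" "y \<in> P j" "a \<in> K" "x = u + c * (y + a * b ^ j)"
        unfolding P_Suc by blast
      have "u + c * y \<in> T (Suc (Suc (r - Suc j)))" unfolding IH using u by blast
      then have "u + c * y \<in> T (Suc (r - Suc j))"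
        using T_antimono[of "Suc (r - Suc j)" "Suc (Suc (r - Suc j))"] by auto
      then have "(u + c * y) + a * (b ^ j * c) \<in> T (Suc (r - Suc j))"
        using Td(2,3) u(3) in' by blast
      then show "x \<in> T (Suc (r - Suc j))"
        using u(4) by (simp add: algebra_simps)
    qed
  qed
  have cP: "c * y \<in> T (Suc r - j)" if "j \<le> r" "y \<in> P j" for j y
    using T_decomp[OF that(1)] that(2) Pd(1) ksubspaceD(1)[OF S'] by force
  have trivial_inter: "y = 0" if "j \<le> r" "y \<in> P j" "c * y \<in> S'" for j y
    using that
  proof (induction j arbitrary: y)
    case 0
    then show ?case by (simp add: P0)
  next
    case (Suc j)
    then obtain x a where x: "x \<in> P j" "a \<in> K" "y = x + a * b ^ j"
      unfolding P_Suc by blast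
    have "c * y \<in> T (Suc r - j)" "c * x \<in> T (Suc r - j)"
      using Suc.prems T_antimono[of "Suc r - j" "Suc r"] cP[of j x] x(1) by (auto simp: S'_def)
    then have "c * y - c * x \<in> T (Suc r - j)" using Td(5) by blast
    then have "a * (b ^ j * c) \<in> T (Suc (r - j))"
      using x(3) Suc.prems(1) by (simp add: algebra_simps Suc_diff_le)
    then have "a = 0"
      using scale_mem_iff[OF T x(2)] bc_notin[of j] Suc.prems(1) by force
    with x Suc show ?case by simp
  qed
  have S_eq: "S = {x + c * y | x y. x \<in> S' \<and> y \<in> P r}"
    using T_decomp[of r] T1 by simp
  have direct: "direct_sum S S' ((\<lambda>x. c * x) ` P r)"
    unfolding direct_sum_def
  proof
    show "S = {x + y | x y. x \<in> S' \<and> y \<in> (\<lambda>x. c * x) ` P r}"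
      by (subst S_eq) blast
    show "S' \<inter> (\<lambda>x. c * x) ` P r = {0}"
      using trivial_inter[of r] Pd(1) ksubspaceD(1)[OF S'] by force
  qed
  have card_P: "card (P j) = q ^ j" if "j \<le> Suc r" for j
    using that
  proof (induction j)
    case 0
    then show ?case by (simp add: P0)
  next
    case (Suc j)
    have "b ^ j \<notin> P j"
    proof
      assume "b ^ j \<in> P j"
      then have "b ^ j * c \<in> T (Suc (r - j))"
        using cP[of j "b ^ j"] Suc.prems by (simp add: mult.commute Suc_diff_le)
      then show False using bc_notin[of j] Suc.prems by simp
    qed
    then show ?case
      using card_add_line[OF P] Suc by (simp add: P_Suc card_K)
  qed
  have card_S_eq: "card S = card S' * card (P r)"
  proof -
    have "inj_on (\<lambda>(x, y). x + c * y) (S' \<times> P r)"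
    proof (rule inj_onI, clarify)
      fix x y x' y'
      assume *: "x \<in> S'" "x' \<in> S'" "y \<in> P r" "y' \<in> P r" "x + c * y = x' + c * y'"
      then have "c * (y - y') = x' - x" by (simp add: algebra_simps)
      then have "c * (y - y') \<in> S'" using * ksubspaceD(5)[OF S'] by simp
      then have "y - y' = 0" using trivial_inter[of r] Pd(5) * by blast
      with * show "x = x' \<and> y = y'" by simp
    qed
    moreover have "(\<lambda>(x, y). x + c * y) ` (S' \<times> P r) = S"
      by (subst S_eq) auto
    ultimately show ?thesis
      by (metis card_image card_cartesian_product)
  qed

  interpret Adj: subfield_space "(*)" "adjoin K b"
    by unfold_locales (rule is_subfield_adjoin)
  have adj: "ksubspace K (*) (adjoin K b)"
    using Adj.K_closed(1,3,4) subset_adjoin[of K b] by (auto simp: ksubspace_def)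
  have card_adj: "card (adjoin K b) = q ^ t"
    unfolding t_def using card_ksubspace[OF adj] by (simp add: card_K)
  define d where "d = kdim (adjoin K b) (*) S'"
  have card_S': "card S' = q ^ (t * d)"
    using Adj.card_ksubspace[OF S'_adj] card_adj by (simp add: d_def power_mult)
  have "q ^ (n - 2) = q ^ (t * d + r)"
    using card_S_eq card_S card_S' card_P[of r] by (simp add: power_add)
  then have dim_eq: "n - 2 = t * d + r" by (simp only: power_q_cancel)
  have "P (Suc r) \<subseteq> adjoin K b"
    unfolding P_def
  proof (rule kspan_subset[OF adj], rule image_subsetI)
    fix i show "b ^ i \<in> adjoin K b"
      by (induction i) (auto intro: Adj.K_closed mem_adjoin)
  qed
  then have "q ^ Suc r \<le> q ^ t"
    using card_mono[of "adjoin K b" "P (Suc r)"] card_P[of "Suc r"] card_adj by simp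
  then have "r < t" using q_ge_2 by (simp add: power_increasing_iff del: power_Suc)
  define e where "e = kdim (adjoin K b) (*) UNIV"
  have "q ^ n = q ^ (t * e)"
    using Adj.card_ksubspace[of UNIV] card_field card_adj
    by (simp add: e_def power_mult ksubspace_def)
  then have n_eq: "n = t * e" by (simp only: power_q_cancel)
  have "t \<ge> 2"
  proof -
    have "K \<subset> adjoin K b" using b subset_adjoin mem_adjoin by blast
    then have "q ^ 1 < q ^ t" using psubset_card_mono[of "adjoin K b" K] card_adj card_K by simp
    then show ?thesis using q_ge_2 by (subst (asm) power_strict_increasing_iff) auto
  qed
  have "t * e = t * d + (r + 2)" using n_eq dim_eq n by simp
  have "e = Suc d"
  proof -
    have "t * d < t * e" using \<open>t * e = _\<close> by simp
    then have "d < e" by simp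
    have "t * e < t * (d + 2)" using \<open>t * e = _\<close> \<open>r < t\<close> \<open>t \<ge> 2\<close> by (simp add: algebra_simps)
    then have "e < d + 2" by (subst (asm) mult_less_cancel1) auto
    with \<open>d < e\<close> show ?thesis by simp
  qed
  with \<open>t * e = _\<close> have "r = t - 2" by simp
  have d_eq: "d = n div t - 1"
    using n_eq \<open>e = Suc d\<close> \<open>t \<ge> 2\<close> by simp
  show ?thesis
    using that[OF \<open>c \<noteq> 0\<close> S'_adj] d_eq direct \<open>r = t - 2\<close> by (simp add: d_def P_def)
qed

lemma card_kernel_range:
  assumes f: "klinear K f"
  shows "CARD('a) = card {x. f x = 0} * card (range f)"
proof -
  let ?g = "inv f"
  have g: "f (?g y) = y" if "y \<in> range f" for y
    using that by (simp add: f_inv_into_f)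
  have "bij_betw (\<lambda>(k, y). k + ?g y) ({x. f x = 0} \<times> range f) UNIV"
    by (rule bij_betw_byWitness[where f' = "\<lambda>x. (x - ?g (f x), f x)"])
      (auto simp: klinearD[OF f] g)
  from bij_betw_same_card[OF this] show ?thesis
    by (simp add: card_cartesian_product)
qed

lemma ksubspace_range:
  assumes f: "klinear K f"
  shows "ksubspace K (*) (range f)"
  unfolding ksubspace_def
proof (intro conjI ballI)
  show "0 \<in> range f"
    by (rule range_eqI[of _ _ 0]) (simp add: klinearD[OF f])
  show "x + y \<in> range f" if "x \<in> range f" "y \<in> range f" for x y
    using that by (auto simp flip: klinearD(1)[OF f])
  show "a * x \<in> range f" if "a \<in> K" "x \<in> range f" for a x
    using that by (auto simp flip: klinearD(2)[OF f])
qed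

lemma ksubspace_kernel:
  assumes f: "klinear K f"
  shows "ksubspace K (*) {x. f x = 0}"
  by (auto simp: ksubspace_def klinearD[OF f])

lemma ksubspace_K: "ksubspace K (*) K"
  using K_closed by (simp add: ksubspace_def)

lemma club_coordinates:
  fixes W :: "('a ^ 2) set"
  assumes n: "4 \<le> n" and club: "is_club K n (n - 2) W"
  obtains u w f b where "\<forall>x y. x *s u + y *s w = 0 \<longrightarrow> x = 0 \<and> y = 0"
    "W = {x *s u + f x *s w | x. True}" "klinear K f"
    "range f = {a + a' * b | a a'. a \<in> K \<and> a' \<in> K}" "b \<notin> K"
    "card {x. f x = 0} = q ^ (n - 2)" "\<forall>x. f x = 1 \<longrightarrow> f (b * x) \<noteq> b"
proof -
  interpret plane: subfield_space "(*s) :: 'a \<Rightarrow> 'a ^ 2 \<Rightarrow> 'a ^ 2" K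
    by (intro subfield_space.intro subfield_space_axioms.intro vec.vector_space_axioms K_subfield)
  have W: "ksubspace K (*s) W" and "kdim K (*s) W = n"
    using club by (auto simp: is_club_def)
  then have card_W: "card W = q ^ n"
    using plane.card_ksubspace[OF W] by (simp add: card_K)
  note Wd = plane.ksubspaceD[OF W]
  have card_point: "card (W \<inter> vec.span {v}) = q ^ weight K W (vec.span {v})" for v
  proof -
    have "ksubspace K (*s) (W \<inter> vec.span {v})"
      using Wd(1-3) by (auto simp: ksubspace_def vec.span_zero vec.span_add vec.span_scale)
    then show ?thesis
      using plane.card_ksubspace by (simp add: weight_def card_K)
  qed
  obtain P0 where P0: "P0 \<in> linear_set W" "weight K W P0 = n - 2"
    and P0_unique: "\<And>P. P \<in> linear_set W \<Longrightarrow> weight K W P = n - 2 \<Longrightarrow> P = P0"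
    using club unfolding is_club_def by (metis (no_types, lifting))
  obtain u where u: "u \<in> W" "u \<noteq> 0" "P0 = vec.span {u}"
    using P0(1) unfolding linear_set_def by blast
  have indep: "x = 0 \<and> y = 0" if "w \<notin> vec.span {u}" "x *s u + y *s w = 0" for x y w
  proof -
    have "y = 0"
    proof (rule ccontr)
      assume "y \<noteq> 0"
      have "y *s w = (- x) *s u"
        using that(2) by (simp add: eq_neg_iff_add_eq_0 add.commute)
      then have "y *s w \<in> vec.span {u}" by (simp add: vec.span_base vec.span_scale vec.span_neg)
      then have "inverse y *s (y *s w) \<in> vec.span {u}" by (rule vec.span_scale)
      then show False using that(1) \<open>y \<noteq> 0\<close> by simp
    qed
    then show ?thesis using that(2) u(2) by simp
  qed
  have indep_eq: "x = x' \<and> y = y'"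
    if "w \<notin> vec.span {u}" "x *s u + y *s w = x' *s u + y' *s w" for x y x' y' w
  proof -
    have "(x - x') *s u + (y - y') *s w = 0"
      using that(2) by (simp add: vec.scale_left_diff_distrib algebra_simps)
    from indep[OF that(1) this] show ?thesis by simp
  qed
  have card_plane: "CARD('a ^ 2) = CARD('a) * CARD('a)"
    by (simp add: power2_eq_square)
  have "vec.span {u} \<noteq> UNIV"
  proof
    assume "vec.span {u} = UNIV"
    then have "CARD('a ^ 2) \<le> CARD('a)"
      by (metis vec.span_singleton card_image_le finite)
    moreover have "2 \<le> CARD('a)"
      using card_subfield_ge_2[of "UNIV :: 'a set"] by (simp add: is_subfield_def)
    ultimately show False unfolding card_plane by simp
  qed
  then obtain w1 where w1: "w1 \<notin> vec.span {u}" by blast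

  obtain w where w: "w \<notin> vec.span {u}" and Ww: "\<And>y. y *s w \<in> W \<Longrightarrow> y = 0"
  proof -
    have "\<exists>z. \<forall>y. y *s (z *s u + w1) \<in> W \<longrightarrow> y = 0"
    proof (rule ccontr)
      assume "\<not> ?thesis"
      then obtain l where l: "\<And>z. l z *s (z *s u + w1) \<in> W" "\<And>z. l z \<noteq> 0"
        by metis
      let ?g = "\<lambda>z. l z *s (z *s u + w1)"
      have "inj ?g"
      proof (rule injI)
        fix z z' assume "?g z = ?g z'"
        then have "(l z * z) *s u + l z *s w1 = (l z' * z') *s u + l z' *s w1"
          by (simp add: vec.scale_right_distrib)
        from indep_eq[OF w1 this] l(2)[of z] show "z = z'" by auto
      qed
      moreover have "?g z \<in> W - {0}" for z
      proof -
        have "z *s u + w1 \<noteq> 0"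
          using indep[OF w1, of z 1] by auto
        then show ?thesis using l[of z] vec.scale_eq_0_iff by blast
      qed
      ultimately have "CARD('a) \<le> card (W - {0})"
        by (intro card_inj_on_le[of ?g]) auto
      also have "\<dots> < card W"
        using Wd(1) by (intro psubset_card_mono) auto
      finally show False by (simp add: card_W card_field)
    qed
    then obtain z where z: "\<And>y. y *s (z *s u + w1) \<in> W \<Longrightarrow> y = 0" by blast
    have "z *s u + w1 \<notin> vec.span {u}"
      using w1 vec.span_base[of u "{u}"] vec.span_scale[of u "{u}" z] vec.span_add_eq by blast
    with z that show ?thesis by blast
  qed

  have coord_inj: "inj (\<lambda>(x, y). x *s u + y *s w)"
    by (rule injI) (use indep_eq[OF w] in auto)
  have "range (\<lambda>(x, y). x *s u + y *s w) = UNIV"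
    by (rule card_subset_eq) (simp_all add: card_image[OF coord_inj] power2_eq_square)
  then have coord: "\<exists>x y. v = x *s u + y *s w" for v
    using UNIV_I[of v] by (auto simp: image_iff set_eq_iff)
  define R where "R = {(x, y). x *s u + y *s w \<in> W}"
  have R_unique: "y = y'" if "(x, y) \<in> R" "(x, y') \<in> R" for x y y'
  proof -
    have "(x *s u + y *s w) - (x *s u + y' *s w) \<in> W"
      by (rule Wd(5)) (use that in \<open>simp_all add: R_def\<close>)
    then have "(y - y') *s w \<in> W"
      by (simp add: vec.scale_left_diff_distrib)
    then show ?thesis using Ww[of "y - y'"] by simp
  qed
  have "(\<lambda>(x, y). x *s u + y *s w) ` R = W"
  proof (intro equalityI subsetI)
    fix v assume "v \<in> W"
    moreover obtain x y where "v = x *s u + y *s w" using coord by blast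
    ultimately show "v \<in> (\<lambda>(x, y). x *s u + y *s w) ` R"
      by (intro image_eqI[of _ _ "(x, y)"]) (simp_all add: R_def)
  qed (auto simp: R_def)
  then have "card R = q ^ n"
    using card_image[OF inj_on_subset[OF coord_inj subset_UNIV], of R] card_W by simp
  moreover have "inj_on fst R"
    using R_unique by (auto simp: inj_on_def)
  ultimately have "card (fst ` R) = CARD('a)"
    by (simp add: card_image card_field)
  then have fst_R: "fst ` R = UNIV"
    by (intro card_subset_eq) auto
  then have "\<exists>y. (x, y) \<in> R" for x
    by (metis UNIV_I imageE prod.collapse)
  then obtain f0 where "\<And>x. (x, f0 x) \<in> R" by metis
  then have R_iff: "x *s u + y *s w \<in> W \<longleftrightarrow> y = f0 x" for x y
    using R_unique unfolding R_def by blast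
  have f0: "klinear K f0"
    unfolding klinear_def
  proof (intro conjI allI ballI)
    fix x y
    have "(x *s u + f0 x *s w) + (y *s u + f0 y *s w) \<in> W"
      using Wd(2) R_iff by blast
    then have "(x + y) *s u + (f0 x + f0 y) *s w \<in> W"
      by (simp add: vec.scale_left_distrib add_ac)
    then show "f0 (x + y) = f0 x + f0 y"
      unfolding R_iff by (rule sym)
  next
    fix a x assume "a \<in> K"
    then have "a *s (x *s u + f0 x *s w) \<in> W"
      using Wd(3) R_iff by blast
    then have "(a * x) *s u + (a * f0 x) *s w \<in> W"
      by (simp add: vec.scale_right_distrib)
    then show "f0 (a * x) = a * f0 x"
      unfolding R_iff by (rule sym)
  qed
  have "(\<lambda>x. x *s u) ` {x. f0 x = 0} = W \<inter> vec.span {u}"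
    using R_iff[of _ 0] by (auto simp: vec.span_singleton)
  moreover have "inj (\<lambda>x. x *s u)"
    using u(2) by (auto simp: inj_def)
  ultimately have card_ker: "card {x. f0 x = 0} = q ^ (n - 2)"
    using card_point[of u] P0(2) u(3) by (metis card_image inj_on_subset subset_UNIV)
  have "q ^ (n - 2) < q ^ n"
    using n q_ge_2 by (intro power_strict_increasing) auto
  then have "{x. f0 x = 0} \<noteq> UNIV"
    using card_ker card_field by auto
  then obtain x1 where x1: "f0 x1 \<noteq> 0" by blast

  define g where "g = f0 x1"
  define f where "f x = f0 x / g" for x
  have g: "g \<noteq> 0" using x1 by (simp add: g_def)
  have f: "klinear K f"
    by (simp add: klinear_def f_def klinearD[OF f0] add_divide_distrib)
  have ker: "{x. f x = 0} = {x. f0 x = 0}"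
    using g by (simp add: f_def)
  have fw: "f x *s (g *s w) = f0 x *s w" for x
    using g by (simp add: f_def)
  have W_eq: "W = {x *s u + f x *s (g *s w) | x. True}"
    unfolding fw using coord R_iff by (auto, metis)
  have indep': "x = 0 \<and> y = 0" if "x *s u + y *s (g *s w) = 0" for x y
    using indep[OF w, of x "y * g"] that g by simp
  have "q ^ (n - 2) * card (range f) = q ^ (n - 2) * q ^ 2"
  proof -
    have "n - 2 + 2 = n" using n by simp
    then have "q ^ (n - 2) * q ^ 2 = q ^ n" by (metis power_add)
    also have "\<dots> = q ^ (n - 2) * card (range f)"
      using card_kernel_range[OF f] unfolding ker card_ker card_field .
    finally show ?thesis ..
  qed
  then have card_range: "card (range f) = q ^ 2"
    using q_ge_2 by simp
  have one: "1 \<in> range f"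
    by (rule range_eqI[of _ _ x1]) (use g in \<open>simp add: f_def g_def\<close>)
  note fr = ksubspaceD[OF ksubspace_range[OF f]]
  have "q < q ^ 2" using q_ge_2 by (simp add: power2_eq_square)
  have "\<not> range f \<subseteq> K"
  proof
    assume "range f \<subseteq> K"
    then have "card (range f) \<le> card K" by (intro card_mono) auto
    then show False using \<open>q < q ^ 2\<close> by (simp add: card_range card_K)
  qed
  then obtain b where b: "b \<in> range f" "b \<notin> K" by blast
  have range_f: "range f = {a + a' * b | a a'. a \<in> K \<and> a' \<in> K}"
  proof (rule sym, rule card_subset_eq)
    have "a + a' * b \<in> range f" if "a \<in> K" "a' \<in> K" for a a'
      using fr(3)[OF that(1) one] fr(3)[OF that(2) b(1)] fr(2) by simp
    then show "{a + a' * b | a a'. a \<in> K \<and> a' \<in> K} \<subseteq> range f" by blast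
    show "card {a + a' * b | a a'. a \<in> K \<and> a' \<in> K} = card (range f)"
      using card_add_line[OF ksubspace_K b(2)] by (simp add: card_range card_K power2_eq_square)
  qed simp
  have "f (b * x) \<noteq> b" if fx: "f x = 1" for x
  proof
    assume fbx: "f (b * x) = b"
    let ?v = "x *s u + g *s w"
    have "?v \<in> W" using fx by (subst W_eq) (auto intro!: exI[of _ x])
    moreover have v0: "?v \<noteq> 0" using indep'[of x 1] by auto
    ultimately have point: "vec.span {?v} \<in> linear_set W"
      unfolding linear_set_def by blast
    have "?v \<notin> vec.span {u}"
    proof
      assume "?v \<in> vec.span {u}"
      then obtain k where "?v = k *s u" by (auto simp: vec.span_singleton)
      then have "(x - k) *s u + 1 *s (g *s w) = 0"
        by (simp add: vec.scale_left_diff_distrib algebra_simps)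
      from indep'[OF this] show False by simp
    qed
    then have "vec.span {?v} \<noteq> P0"
      using u(3) vec.span_base[of ?v "{?v}"] by auto
    then have "weight K W (vec.span {?v}) = 1"
      using P0_unique[OF point] club point unfolding is_club_def by blast
    then have "card (W \<inter> vec.span {?v}) = q"
      using card_point[of ?v] by simp
    moreover have "card (range f) \<le> card (W \<inter> vec.span {?v})"
    proof (rule card_inj_on_le[of "\<lambda>l. l *s ?v"])
      show "inj_on (\<lambda>l. l *s ?v) (range f)"
        by (rule inj_onI) (use v0 vec.scale_right_imp_eq in blast)
      show "(\<lambda>l. l *s ?v) ` range f \<subseteq> W \<inter> vec.span {?v}"
      proof (rule image_subsetI)
        fix l assume "l \<in> range f"
        then obtain a a' where a: "a \<in> K" "a' \<in> K" "l = a + a' * b"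
          using range_f by blast
        have "f (l * x) = l"
        proof -
          have "f (l * x) = f (a * x + a' * (b * x))" by (simp add: a(3) algebra_simps)
          also have "\<dots> = l" using a fx fbx by (simp add: klinearD[OF f])
          finally show ?thesis .
        qed
        then have "l *s ?v = (l * x) *s u + f (l * x) *s (g *s w)"
          by (simp add: vec.scale_right_distrib)
        then have "l *s ?v \<in> W" by (subst W_eq) blast
        then show "l *s ?v \<in> W \<inter> vec.span {?v}"
          by (intro IntI vec.span_scale vec.span_base singletonI)
      qed
    qed simp
    ultimately show False using \<open>q < q ^ 2\<close> card_range by simp
  qed
  moreover have "card {x. f x = 0} = q ^ (n - 2)" using ker card_ker by simp
  ultimately show ?thesis
    using that[OF _ W_eq f range_f b(2)] indep' by blast
qed

end

lemma linear_set_image: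
  fixes M :: "'a::field ^ 2 ^ 2"
  assumes "inj ((*v) M)"
  shows "(\<lambda>P. (\<lambda>v. M *v v) ` P) ` linear_set U = linear_set ((*v) M ` U)"
proof -
  have span: "(*v) M ` vec.span {v} = vec.span {M *v v}" for v
    by (auto simp: vec.span_singleton image_image vector_scalar_commute)
  have linear_set: "linear_set V = (\<lambda>v. vec.span {v}) ` (V - {0})" for V :: "('a ^ 2) set"
    unfolding linear_set_def by blast
  have "M *v v = 0 \<longleftrightarrow> v = 0" for v
    using assms by (metis injD matrix_vector_mult_0_right)
  then have "(*v) M ` U - {0} = (*v) M ` (U - {0})"
    by auto
  then show ?thesis
    unfolding linear_set by (simp only: image_image span)
qed

lemma pgl_equivalent_graph:
  fixes u w :: "'a::field ^ 2"
  assumes indep: "\<forall>x y. x *s u + y *s w = 0 \<longrightarrow> x = 0 \<and> y = 0"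
  shows "pgl_equivalent (linear_set {x *s u + f x *s w | x. True}) (linear_set (graph_of f))"
proof -
  define N :: "'a ^ 2 ^ 2" where "N = (\<chi> i j. if j = 1 then u $ i else w $ i)"
  have N: "N *v v = v $ 1 *s u + v $ 2 *s w" for v
    by (simp add: N_def matrix_vector_mult_def vec_eq_iff sum_2 mult.commute)
  have "v = 0" if "N *v v = 0" for v
  proof -
    have "v $ 1 = 0 \<and> v $ 2 = 0" using that indep unfolding N by blast
    then show ?thesis by (simp add: vec_eq_iff forall_2)
  qed
  then have "\<exists>M. M ** N = mat 1"
    using matrix_left_invertible_ker[of N] by blast
  then obtain M where M: "M ** N = mat 1" by blast
  then have inv: "invertible M"
    using matrix_left_right_inverse unfolding invertible_def by blast
  have MN: "M *v (N *v v) = v" for v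
    by (simp add: matrix_vector_mul_assoc M)
  have "(*v) M ` {x *s u + f x *s w | x. True} = graph_of f"
  proof -
    have "M *v (x *s u + f x *s w) = vector [x, f x]" for x
      using MN[of "vector [x, f x]"] by (simp add: N)
    then show ?thesis
      unfolding graph_of_def by (auto simp: image_iff) metis
  qed
  moreover have "inj ((*v) M)"
    using inv by (simp add: inj_matrix_vector_mult)
  ultimately have "(\<lambda>P. (\<lambda>v. M *v v) ` P) ` linear_set {x *s u + f x *s w | x. True}
      = linear_set (graph_of f)"
    by (simp only: linear_set_image)
  with inv show ?thesis
    unfolding pgl_equivalent_def by blast
qed

theorem theorem5p4:
  fixes K :: "'a::{field,finite} set" and W :: "('a ^ 2) set" and q n :: nat
  assumes "primepow q"
    and "CARD('a) = q ^ n"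
    and "is_subfield K" and "card K = q"
    and "n \<ge> 5"
    and "is_club K n (n - 2) W"
  shows "\<exists>b \<xi> \<eta>. b \<notin> K \<and> \<xi> \<noteq> 0 \<and> \<eta> \<noteq> 0 \<and>
    pgl_equivalent (linear_set W)
      (linear_set (graph_of (\<lambda>x. field_trace q n (\<xi> * x) + b * field_trace q n (\<eta> * x)))) \<and>
    (let Fqt = adjoin K b; t = kdim K (*) Fqt in
      \<exists>c S. c \<noteq> 0 \<and> ksubspace Fqt (*) S \<and> kdim Fqt (*) S = n div t - 1 \<and>
        direct_sum (trace_perp q n (kspan K (*) {\<xi>, \<eta>})) S
          ((\<lambda>x. c * x) ` kspan K (*) ((\<lambda>i. b ^ i) ` {..<t - 2})))"
proof -
  interpret finite_extension K q n
    using assms by unfold_locales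
  have n: "4 \<le> n" "2 \<le> n" using \<open>n \<ge> 5\<close> by auto
  obtain u w f b where
    indep: "\<forall>x y. x *s u + y *s w = 0 \<longrightarrow> x = 0 \<and> y = 0"
    and W: "W = {x *s u + f x *s w | x. True}" and f: "klinear K f"
    and range_f: "range f = {a + a' * b | a a'. a \<in> K \<and> a' \<in> K}" and b: "b \<notin> K"
    and card_ker: "card {x. f x = 0} = q ^ (n - 2)"
    and no_double: "\<forall>x. f x = 1 \<longrightarrow> f (b * x) \<noteq> b"
    using club_coordinates[OF n(1) \<open>is_club K n (n - 2) W\<close>] .

  have coeff_unique: "a = c \<and> a' = c'"
    if K: "a \<in> K" "a' \<in> K" "c \<in> K" "c' \<in> K" and eq: "a + b * a' = c + b * c'" for a a' c c'
  proof -
    have "a' = c'"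
    proof (rule ccontr)
      assume "a' \<noteq> c'"
      moreover have "b * (a' - c') = c - a" using eq by (simp add: algebra_simps)
      ultimately have "b = (c - a) / (a' - c')" by (simp add: field_simps)
      then show False using b K K_closed(7,8) by metis
    qed
    with eq show ?thesis by simp
  qed
  have "\<exists>a a'. a \<in> K \<and> a' \<in> K \<and> f x = a + b * a'" for x
  proof -
    have "f x \<in> {a + a' * b | a a'. a \<in> K \<and> a' \<in> K}"
      unfolding range_f[symmetric] by (rule rangeI)
    then show ?thesis by (auto simp: mult.commute[of b])
  qed
  then obtain f1 f2 where K1: "\<And>x. f1 x \<in> K" and K2: "\<And>x. f2 x \<in> K"
    and f_eq: "\<And>x. f x = f1 x + b * f2 x"
    by metis
  have add: "f1 (x + y) = f1 x + f1 y \<and> f2 (x + y) = f2 x + f2 y" for x y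
    using klinearD(1)[OF f, of x y]
    by (intro coeff_unique) (auto simp: K1 K2 K_closed f_eq algebra_simps)
  have scale: "f1 (a * x) = a * f1 x \<and> f2 (a * x) = a * f2 x" if "a \<in> K" for a x
    using klinearD(2)[OF f that, of x] that
    by (intro coeff_unique) (auto simp: K1 K2 K_closed f_eq algebra_simps)
  have "klinear K f1" "klinear K f2"
    using add scale by (auto simp: klinear_def)
  moreover have "range f1 \<subseteq> K" "range f2 \<subseteq> K"
    using K1 K2 by auto
  ultimately obtain \<xi> \<eta> where f1: "f1 = (\<lambda>x. Tr (\<xi> * x))" and f2: "f2 = (\<lambda>x. Tr (\<eta> * x))"
    by (metis functional_eq_trace)
  have f_trace: "f = (\<lambda>x. Tr (\<xi> * x) + b * Tr (\<eta> * x))"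
    using f_eq f1 f2 by auto

  have "1 = 1 + 0 * b" "b = 0 + 1 * b" by simp_all
  then have "1 \<in> range f" "b \<in> range f"
    unfolding range_f using K_closed(1,2) by blast+
  then obtain x0 y0 where x0: "f x0 = 1" and y0: "f y0 = b"
    by (metis rangeE)
  have "f1 x0 = 1" "f2 y0 = 1"
    using coeff_unique[of "f1 x0" "f2 x0" 1 0] coeff_unique[of "f1 y0" "f2 y0" 0 1]
      K1 K2 K_closed(1,2) x0 y0 f_eq by auto
  moreover have "Tr 0 = 0" by (rule klinearD(3)[OF klinear_trace])
  ultimately have nz: "\<xi> \<noteq> 0" "\<eta> \<noteq> 0" using f1 f2 by auto

  define S where "S = {x. f x = 0}"
  have perp: "trace_perp q n (kspan K (*) {\<xi>, \<eta>}) = S"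
  proof (intro equalityI subsetI)
    fix x assume "x \<in> trace_perp q n (kspan K (*) {\<xi>, \<eta>})"
    then have "Tr (\<xi> * x) = 0" "Tr (\<eta> * x) = 0"
      using kspan_superset[of "{\<xi>, \<eta>}"] by (auto simp: trace_perp_def mult.commute)
    then show "x \<in> S" by (simp add: S_def f_trace)
  next
    fix x assume "x \<in> S"
    then have "f1 x = 0" "f2 x = 0"
      using coeff_unique[of "f1 x" "f2 x" 0 0] K1 K2 K_closed(1) f_eq[of x] by (auto simp: S_def)
    then have "{\<xi>, \<eta>} \<subseteq> {y. Tr (x * y) = 0}"
      by (auto simp: f1 f2 mult.commute)
    then have "kspan K (*) {\<xi>, \<eta>} \<subseteq> {y. Tr (x * y) = 0}"
      by (intro kspan_subset ksubspace_kernel klinear_trace_mult)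
    then show "x \<in> trace_perp q n (kspan K (*) {\<xi>, \<eta>})"
      by (auto simp: trace_perp_def)
  qed

  have shift: "y0 - b * x0 \<notin> {x + b * y | x y. x \<in> S \<and> y \<in> S}"
  proof
    assume "y0 - b * x0 \<in> {x + b * y | x y. x \<in> S \<and> y \<in> S}"
    then obtain x y where xy: "x \<in> S" "y \<in> S" "y0 - b * x0 = x + b * y" by blast
    have "f (x0 + y) = 1"
      using xy(2) x0 by (simp add: klinearD[OF f] S_def)
    moreover have "b * (x0 + y) = y0 - x"
      using xy(3) by (simp add: algebra_simps)
    then have "f (b * (x0 + y)) = b"
      using xy(1) y0 by (simp add: klinearD[OF f] S_def)
    ultimately show False using no_double by blast
  qed
  have "ksubspace K (*) S" unfolding S_def by (rule ksubspace_kernel[OF f])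
  then obtain c S' where "c \<noteq> 0" "ksubspace (adjoin K b) (*) S'"
    "kdim (adjoin K b) (*) S' = n div kdim K (*) (adjoin K b) - 1"
    "direct_sum S S'
      ((\<lambda>x. c * x) ` kspan K (*) ((\<lambda>i. b ^ i) ` {..<kdim K (*) (adjoin K b) - 2}))"
    using subspace_shift_structure[OF _ _ n(2) b shift] card_ker S_def by metis
  then have "let Fqt = adjoin K b; t = kdim K (*) Fqt in
      \<exists>c S. c \<noteq> 0 \<and> ksubspace Fqt (*) S \<and> kdim Fqt (*) S = n div t - 1 \<and>
        direct_sum (trace_perp q n (kspan K (*) {\<xi>, \<eta>})) S
          ((\<lambda>x. c * x) ` kspan K (*) ((\<lambda>i. b ^ i) ` {..<t - 2}))"
    unfolding Let_def perp by blast
  moreover have "pgl_equivalent (linear_set W)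
      (linear_set (graph_of (\<lambda>x. Tr (\<xi> * x) + b * Tr (\<eta> * x))))"
    using pgl_equivalent_graph[OF indep, of f]
    unfolding W[symmetric] f_trace[symmetric] .
  ultimately show ?thesis
    using b nz by blast
qed

end
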